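(* For every $k\ge 1$, the Fibonacci-type tree $T_k$ is both a local amoeba and a global amoeba.
   Context: Fibonacci-type trees: $T_1$ and $T_2$ are both isomorphic to $K_2$; for $k\ge 3$, $T_k$ is obtained from the disjoint union of a copy $H$ of $T_{k-1}$ and a copy $J$ of $T_{k-2}$ by adding an edge $uv$, where $u$ is a vertex of maximum degree in $H$ and $v$ is a vertex of maximum degree in $J$. (This is well defined up to isomorphism: each such tree has either a unique vertex of maximum degree or exactly two, interchanged by an automorphism.) Graphs are finite and simple. $S_X$ is the symmetric group on a finite set $X$, $S_n=S_{\{1,\dots,n\}}$. A labeling of a graph $G$ with vertex set $V$ is a bijection $\lambda:V\to X$; write $v_x=\lambda^{-1}(x)$ and $L_G=\{ij : v_iv_j\in E(G)\}$ (no distinction between $ij$ and $ji$). For $\sigma\in S_X$, $G_\sigma$ is the graph on $V$ with edge set $\{v_iv_j : \sigma(i)\sigma(j)\in L_G\}$. A feasible edge-replacement $rs\to kl$ is given by an edge $v_rv_s\in E(G)$ and a non-edge $v_kv_l\in E(\overline G)$ with $G-v_rv_s+v_kv_l\cong G$; the neutral replacement $\emptyset\to\emptyset$ is also considered feasible. $R_G$ is the set of all feasible edge-replacements. Put $\mathrm{Fer}_G(rs\to kl)=\{\sigma\in S_X : G_\sigma=G-v_rv_s+v_kv_l\}$, $\mathrm{Fer}_G(\emptyset\to\emptyset)=\{\sigma\in S_X : G_\sigma=G\}$, and let $\mathrm{Fer}(G)\le S_X$ be the group generated by $\bigcup_{e\to e'\in R_G}\mathrm{Fer}_G(e\to e')$.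 A graph $G$ of order $n$ is a local amoeba if $\mathrm{Fer}(G)\cong S_n$, and a global amoeba if $\mathrm{Fer}(G\cup K_1)\cong S_{n+1}$, where $G\cup K_1$ is $G$ plus an isolated vertex. *)

theory Defs
  imports "HOL-Algebra.Sym_Groups"
begin

record 'a graph =
  verts :: "'a set"
  edges :: "'a set set"

definition simple_graph :: "'a graph \<Rightarrow> bool" where
  "simple_graph G \<longleftrightarrow> finite (verts G) \<and> (\<forall>e\<in>edges G. e \<subseteq> verts G \<and> card e = 2)"

definition graph_iso :: "'a graph \<Rightarrow> 'b graph \<Rightarrow> bool" where
  "graph_iso G H \<longleftrightarrow>
     (\<exists>f. bij_betw f (verts G) (verts H) \<and> edges H = (\<lambda>e. f ` e) ` edges G)"

definition degree :: "'a graph \<Rightarrow> 'a \<Rightarrow> nat" where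
  "degree G v = card {e \<in> edges G. v \<in> e}"

definition max_degree_vertex :: "'a graph \<Rightarrow> 'a \<Rightarrow> bool" where
  "max_degree_vertex G u \<longleftrightarrow> u \<in> verts G \<and> (\<forall>w\<in>verts G. degree G w \<le> degree G u)"

text \<open>The vertex added to \<open>G\<close> is \<^term>\<open>None\<close>, so the type \<open>'a\<close> need not have a spare element.\<close>

definition add_isolated :: "'a graph \<Rightarrow> 'a option graph" where
  "add_isolated G =
     \<lparr>verts = insert None (Some ` verts G), edges = (\<lambda>e. Some ` e) ` edges G\<rparr>"

text \<open>
  \<open>fibonacci_tree k G\<close> says that \<open>G\<close> is a copy of the \<open>k\<close>-th Fibonacci-type tree. Any choice of
  maximum-degree vertices is allowed in the recursive step. No graph satisfies the predicate
  for \<open>k = 0\<close>.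
\<close>

inductive fibonacci_tree :: "nat \<Rightarrow> 'a graph \<Rightarrow> bool" where
  fib_1: "a \<noteq> b \<Longrightarrow> fibonacci_tree 1 \<lparr>verts = {a, b}, edges = {{a, b}}\<rparr>"
| fib_2: "a \<noteq> b \<Longrightarrow> fibonacci_tree 2 \<lparr>verts = {a, b}, edges = {{a, b}}\<rparr>"
| fib_step:
    "\<lbrakk>k \<ge> 3; fibonacci_tree (k - 1) H; fibonacci_tree (k - 2) J;
      verts H \<inter> verts J = {}; max_degree_vertex H u; max_degree_vertex J v\<rbrakk>
     \<Longrightarrow> fibonacci_tree k
          \<lparr>verts = verts H \<union> verts J, edges = insert {u, v} (edges H \<union> edges J)\<rparr>"

definition labeling :: "'a graph \<Rightarrow> 'x set \<Rightarrow> ('a \<Rightarrow> 'x) \<Rightarrow> bool" where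
  "labeling G X lab \<longleftrightarrow> bij_betw lab (verts G) X"

definition vertex_of :: "'a graph \<Rightarrow> ('a \<Rightarrow> 'x) \<Rightarrow> 'x \<Rightarrow> 'a" where
  "vertex_of G lab = inv_into (verts G) lab"

definition label_edges :: "'a graph \<Rightarrow> 'x set \<Rightarrow> ('a \<Rightarrow> 'x) \<Rightarrow> 'x set set" where
  "label_edges G X lab =
     {{i, j} | i j. i \<in> X \<and> j \<in> X \<and> {vertex_of G lab i, vertex_of G lab j} \<in> edges G}"

definition permuted_graph ::
    "'a graph \<Rightarrow> 'x set \<Rightarrow> ('a \<Rightarrow> 'x) \<Rightarrow> ('x \<Rightarrow> 'x) \<Rightarrow> 'a graph" where
  "permuted_graph G X lab \<sigma> =
     \<lparr>verts = verts G,
      edges = {{vertex_of G lab i, vertex_of G lab j} | i j.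
                 i \<in> X \<and> j \<in> X \<and> {\<sigma> i, \<sigma> j} \<in> label_edges G X lab}\<rparr>"

text \<open>\<open>Replace {r, s} {k, l}\<close> stands for \<open>rs \<rightarrow> kl\<close> and \<open>Neutral\<close> for \<open>\<emptyset> \<rightarrow> \<emptyset>\<close>.\<close>

datatype 'x replacement = Neutral | Replace "'x set" "'x set"

fun apply_replacement :: "'a graph \<Rightarrow> ('a \<Rightarrow> 'x) \<Rightarrow> 'x replacement \<Rightarrow> 'a graph" where
  "apply_replacement G lab Neutral = G"
| "apply_replacement G lab (Replace e e') =
     \<lparr>verts = verts G,
      edges = insert (vertex_of G lab ` e') (edges G - {vertex_of G lab ` e})\<rparr>"

definition feasible_replacements ::
    "'a graph \<Rightarrow> 'x set \<Rightarrow> ('a \<Rightarrow> 'x) \<Rightarrow> 'x replacement set" where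
  "feasible_replacements G X lab =
     insert Neutral
       {Replace {r, s} {k, l} | r s k l.
          r \<in> X \<and> s \<in> X \<and> k \<in> X \<and> l \<in> X \<and>
          {vertex_of G lab r, vertex_of G lab s} \<in> edges G \<and>
          k \<noteq> l \<and> {vertex_of G lab k, vertex_of G lab l} \<notin> edges G \<and>
          graph_iso (apply_replacement G lab (Replace {r, s} {k, l})) G}"

text \<open>The same encoding as \<^const>\<open>sym_group\<close>, on an arbitrary set.\<close>

definition sym_group_on :: "'x set \<Rightarrow> ('x \<Rightarrow> 'x) monoid" where
  "sym_group_on X = \<lparr>carrier = {p. p permutes X}, mult = (\<circ>), one = id\<rparr>"

definition Fer_perms ::
    "'a graph \<Rightarrow> 'x set \<Rightarrow> ('a \<Rightarrow> 'x) \<Rightarrow> 'x replacement \<Rightarrow> ('x \<Rightarrow> 'x) set" where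
  "Fer_perms G X lab \<rho> =
     {\<sigma>. \<sigma> permutes X \<and> permuted_graph G X lab \<sigma> = apply_replacement G lab \<rho>}"

definition Fer :: "'a graph \<Rightarrow> 'x set \<Rightarrow> ('a \<Rightarrow> 'x) \<Rightarrow> ('x \<Rightarrow> 'x) monoid" where
  "Fer G X lab =
     subgroup_generated (sym_group_on X)
       (\<Union>\<rho>\<in>feasible_replacements G X lab. Fer_perms G X lab \<rho>)"

text \<open>
  Up to isomorphism the group does not depend on the labeling, so quantifying over all
  labelings agrees with fixing one. Labels are natural numbers because a definition cannot
  quantify over types; every finite graph has such a labeling.
\<close>

definition local_amoeba :: "'a graph \<Rightarrow> bool" where
  "local_amoeba G \<longleftrightarrow>
     simple_graph G \<and>
     (\<forall>(X :: nat set) lab. labeling G X lab \<longrightarrow> Fer G X lab \<cong> sym_group (card (verts G)))"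

definition global_amoeba :: "'a graph \<Rightarrow> bool" where
  "global_amoeba G \<longleftrightarrow>
     simple_graph G \<and>
     (\<forall>(X :: nat set) lab. labeling (add_isolated G) X lab \<longrightarrow>
        Fer (add_isolated G) X lab \<cong> sym_group (card (verts G) + 1))"

lemma fibonacci_tree_simple:
  assumes "fibonacci_tree k G"
  shows "simple_graph G \<and> verts G \<noteq> {}"
  using assms
proof induction
  case (fib_step k H J u v)
  then have "u \<noteq> v" "u \<in> verts H" "v \<in> verts J"
    by (auto simp: max_degree_vertex_def)
  with fib_step.IH show ?case by (auto simp: simple_graph_def)
qed (auto simp: simple_graph_def)

definition map_graph :: "('a \<Rightarrow> 'b) \<Rightarrow> 'a graph \<Rightarrow> 'b graph" where
  "map_graph f G = \<lparr>verts = f ` verts G, edges = (\<lambda>e. f ` e) ` edges G\<rparr>"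

lemma degree_map_graph:
  assumes "inj f"
  shows "degree (map_graph f G) (f v) = degree G v"
proof -
  have "{e \<in> (\<lambda>e. f ` e) ` edges G. f v \<in> e} = (\<lambda>e. f ` e) ` {e \<in> edges G. v \<in> e}"
    using assms by (auto dest: injD)
  moreover have "inj_on (\<lambda>e. f ` e) {e \<in> edges G. v \<in> e}"
    using assms by (auto simp: inj_on_def inj_image_eq_iff)
  ultimately show ?thesis
    by (simp add: degree_def map_graph_def card_image)
qed

lemma max_degree_vertex_map_graph:
  assumes "inj f" "max_degree_vertex G u"
  shows "max_degree_vertex (map_graph f G) (f u)"
  using assms degree_map_graph[OF assms(1)]
  by (auto simp: max_degree_vertex_def map_graph_def)

lemma fibonacci_tree_map_graph:
  fixes f :: "'a \<Rightarrow> 'b"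
  assumes "fibonacci_tree k G" "inj f"
  shows "fibonacci_tree k (map_graph f G)"
  using assms(1)
proof induction
  case (fib_1 a b)
  then have "f a \<noteq> f b" using assms(2) by (auto dest: injD)
  from fibonacci_tree.fib_1[OF this] show ?case by (simp add: map_graph_def)
next
  case (fib_2 a b)
  then have "f a \<noteq> f b" using assms(2) by (auto dest: injD)
  from fibonacci_tree.fib_2[OF this] show ?case by (simp add: map_graph_def)
next
  case (fib_step k H J u v)
  have "verts (map_graph f H) \<inter> verts (map_graph f J) = {}"
    using fib_step.hyps assms(2) by (auto simp: map_graph_def dest: injD)
  from fibonacci_tree.fib_step[OF \<open>k \<ge> 3\<close> fib_step.IH this
      max_degree_vertex_map_graph[OF assms(2) \<open>max_degree_vertex H u\<close>]
      max_degree_vertex_map_graph[OF assms(2) \<open>max_degree_vertex J v\<close>]]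
  show ?case by (simp add: map_graph_def image_Un)
qed

lemma ex_max_degree_vertex:
  assumes "simple_graph G" "verts G \<noteq> {}"
  shows "\<exists>u. max_degree_vertex G u"
proof -
  have fin: "finite (degree G ` verts G)" using assms by (simp add: simple_graph_def)
  then have "Max (degree G ` verts G) \<in> degree G ` verts G" using assms by simp
  then obtain u where "u \<in> verts G" "degree G u = Max (degree G ` verts G)" by auto
  then show ?thesis using fin by (auto simp: max_degree_vertex_def)
qed

lemma fibonacci_tree_exists:
  assumes "k \<ge> 1"
  shows "\<exists>G :: nat graph. fibonacci_tree k G"
  using assms
proof (induction k rule: less_induct)
  case (less k)
  consider "k = 1" | "k = 2" | "k \<ge> 3" using less.prems by linarith
  then show ?case
  proof cases
    case 1
    then show ?thesis using fib_1[of "0::nat" 1] by auto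
  next
    case 2
    then show ?thesis using fib_2[of "0::nat" 1] by auto
  next
    case 3
    have "k - 1 < k" "k - 1 \<ge> 1" "k - 2 < k" "k - 2 \<ge> 1" using 3 by linarith+
    with less.IH obtain H0 J0 :: "nat graph" where H0: "fibonacci_tree (k - 1) H0"
      and J0: "fibonacci_tree (k - 2) J0"
      by meson
    define H where "H = map_graph (\<lambda>x. 2 * x) H0"
    define J where "J = map_graph (\<lambda>x. 2 * x + 1) J0"
    have H: "fibonacci_tree (k - 1) H" and J: "fibonacci_tree (k - 2) J"
      unfolding H_def J_def
      using fibonacci_tree_map_graph[OF H0, of "\<lambda>x. 2 * x"]
        fibonacci_tree_map_graph[OF J0, of "\<lambda>x. 2 * x + 1"]
      by (simp_all add: inj_def)
    have disj: "verts H \<inter> verts J = {}"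
      by (auto simp: H_def J_def map_graph_def) presburger
    obtain u v where "max_degree_vertex H u" "max_degree_vertex J v"
      using ex_max_degree_vertex fibonacci_tree_simple H J by metis
    from fib_step[OF 3 H J disj this] show ?thesis by blast
  qed
qed

end

theory Submission
  imports Defs
begin

text \<open>
  A permutation of the vertices whose action on the edge set changes at most one edge is called a
  near-automorphism here. Up to inversion these are the permutations collected in the sets
  \<open>Fer\<close> of the feasible replacements, so \<open>Fer(G)\<close> is the group that they generate. It is the full
  symmetric group as soon as it contains every transposition. "The transposition of \<open>x\<close> and \<open>y\<close> lies in
  the group" is an equivalence relation on the vertices, and it is preserved by every
  near-automorphism (conjugation). The relation \<open>exchangeable\<close> below is generated by these closure
  properties from the transpositions that are near-automorphisms, and a graph is an amoeba once this
  relation has a single class.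

  The maximum degree vertex where the recursion joins the trees is a root of \<open>T_k\<close>, so
  \<open>T_k\<close> is \<open>T_{k-1}\<close> with a copy of \<open>T_{k-2}\<close> hung below its root. Two copies of the
  same rooted tree can be swapped by an automorphism if their roots are adjacent or have a common
  neighbour, and no other edges lead out of them. They can still be swapped by a near-automorphism
  when one of them has a further edge leading out of it, because only that edge is destroyed. Such pairs occur everywhere in \<open>T_k\<close>, since
  \<open>T_{j+1}\<close> is itself a copy of \<open>T_j\<close> with one further edge at the root.

  First, all vertices other than the root are exchangeable through near-automorphisms that fix the
  root (\<open>exchangeable_nonroot\<close>), by induction on \<open>k\<close>. The induction hypothesis
  applies to the two parts \<open>H = T_{k-1}\<close> and \<open>J = T_{k-2}\<close>, because a permutation
  fixing the root of a part does not touch the rest of the tree. For \<open>k \<ge> 4\<close> the root of \<open>H\<close> has a child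
  that roots a copy of \<open>T_{k-3}\<close>, and \<open>J\<close> contains another copy around its root; swapping the two
  copies transports exchangeability from \<open>H\<close> into \<open>J\<close> and links the two classes.
  Second, \<open>H\<close> contains a copy of \<open>T_{k-2}\<close> around its root, and swapping it with
  \<open>J\<close> moves the root, which therefore is exchangeable with the rest
  (\<open>exchangeable_vertices\<close>). Third, an isolated vertex is exchangeable with a leaf, since their
  transposition affects only the edge at the leaf (\<open>exchangeable_add_isolated\<close>). The lemma
  \<open>Fer_iso_sym_group\<close> turns these facts into statements about \<open>Fer\<close>.
\<close>

section \<open>Near-automorphisms and exchangeable vertices\<close>

text \<open>
  The image of the edge set may contain one edge \<open>e'\<close> outside it. Since the image has as many
  elements as the edge set, this says that it arises by replacing at most one edge. The set \<open>W\<close>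
  of vertices that may move is a parameter: all vertices, or all vertices but the root.
\<close>

definition near_automorphism :: "'a set \<Rightarrow> 'a set set \<Rightarrow> ('a \<Rightarrow> 'a) \<Rightarrow> bool" where
  "near_automorphism W E p \<longleftrightarrow> p permutes W \<and> (\<exists>e'. (`) p ` E \<subseteq> insert e' E)"

text \<open>
  The rules follow the closure of a group of permutations under conjugation and under
  \<open>(x y)(y z)(x y) = (x z)\<close>, so that every group containing the near-automorphisms contains the
  transpositions of exchangeable elements (\<open>exchangeable_in_subgroup\<close>).
\<close>

inductive exchangeable :: "'a set \<Rightarrow> 'a set set \<Rightarrow> 'a \<Rightarrow> 'a \<Rightarrow> bool" for W E where
  base: "\<lbrakk>x \<in> W; y \<in> W; near_automorphism W E (Transposition.transpose x y)\<rbrakk>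
         \<Longrightarrow> exchangeable W E x y"
| conj: "\<lbrakk>near_automorphism W E p; exchangeable W E x y\<rbrakk> \<Longrightarrow> exchangeable W E (p x) (p y)"
| trans: "\<lbrakk>exchangeable W E x y; exchangeable W E y z\<rbrakk> \<Longrightarrow> exchangeable W E x z"

lemma exchangeable_refl: "x \<in> W \<Longrightarrow> exchangeable W E x x"
proof (rule exchangeable.base)
  show "near_automorphism W E (Transposition.transpose x x)"
    by (auto simp: near_automorphism_def permutes_id)
qed

lemma exchangeable_sym: "exchangeable W E x y \<Longrightarrow> exchangeable W E y x"
proof (induction rule: exchangeable.induct)
  case (base x y)
  then show ?case using exchangeable.base[of y W x E] by (simp add: transpose_commute)
next
  case (conj p x y)
  then show ?case by (blast intro: exchangeable.conj)
next
  case (trans x y z)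
  show ?case by (rule exchangeable.trans[OF trans.IH(2,1)])
qed

lemma exchangeable_in: "exchangeable W E x y \<Longrightarrow> x \<in> W \<and> y \<in> W"
proof (induction rule: exchangeable.induct)
  case (conj p x y)
  then have "p permutes W" by (simp add: near_automorphism_def)
  with conj.IH show ?case by (simp add: permutes_in_image)
qed simp_all

text \<open>
  Near-automorphisms of a part extend by the identity to the whole graph if the edges outside the
  part avoid the vertices that move. With \<open>W\<close> the non-root vertices of the part, this is the case
  for a rooted subtree attached at its root.
\<close>

lemma near_automorphism_mono:
  assumes "near_automorphism W E p" "W \<subseteq> W'" "E \<subseteq> E'" "\<forall>e\<in>E' - E. e \<inter> W = {}"
  shows "near_automorphism W' E' p"
proof -
  obtain e' where p: "p permutes W" and e': "(`) p ` E \<subseteq> insert e' E"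
    using assms(1) by (auto simp: near_automorphism_def)
  have "p ` e = e" if "e \<in> E'" "e \<notin> E" for e
  proof -
    have "p x = x" if "x \<in> e" for x
      using that assms(4) \<open>e \<in> E'\<close> \<open>e \<notin> E\<close> permutes_not_in[OF p] by blast
    then show ?thesis by simp
  qed
  then have "p ` e \<in> insert e' E'" if "e \<in> E'" for e
    using that subsetD[OF e' imageI[of e E]] assms(3) by (cases "e \<in> E") auto
  then have "(`) p ` E' \<subseteq> insert e' E'" by (rule image_subsetI)
  with permutes_subset[OF p assms(2)] show ?thesis
    unfolding near_automorphism_def by blast
qed

lemma exchangeable_mono:
  assumes "exchangeable W E x y" "W \<subseteq> W'" "E \<subseteq> E'" "\<forall>e\<in>E' - E. e \<inter> W = {}"
  shows "exchangeable W' E' x y"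
  using assms(1)
proof (induction rule: exchangeable.induct)
  case (base x y)
  then show ?case
    using near_automorphism_mono[OF base(3) assms(2-4)] assms(2)
    by (intro exchangeable.base) auto
next
  case (conj p x y)
  show ?case
    by (rule exchangeable.conj[OF near_automorphism_mono[OF conj(1) assms(2-4)] conj.IH])
qed (rule exchangeable.trans)

text \<open>
  Relabelling along \<open>f\<close>. The set \<open>U\<close> exceeds \<open>W\<close> because edges may also contain
  vertices that do not move, and \<open>f\<close> has to be injective on those as well.
\<close>

lemma near_automorphism_image:
  assumes "near_automorphism W E p" "inj_on f U" "W \<subseteq> U" "E \<subseteq> Pow U"
  shows "near_automorphism (f ` W) ((`) f ` E) (map_permutation W f p)"
    and "\<And>x. x \<in> U \<Longrightarrow> map_permutation W f p (f x) = f (p x)"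
proof -
  obtain e' where p: "p permutes W" and e': "(`) p ` E \<subseteq> insert e' E"
    using assms(1) by (auto simp: near_automorphism_def)
  have inj: "inj_on f W" using assms(2,3) inj_on_subset by blast
  let ?q = "map_permutation W f p"
  show q: "?q (f x) = f (p x)" if "x \<in> U" for x
  proof (cases "x \<in> W")
    case True
    then show ?thesis using inj by (rule map_permutation_apply[rotated])
  next
    case False
    then have "f x \<notin> f ` W" using assms(2,3) that by (auto dest: inj_onD)
    then show ?thesis using False permutes_not_in[OF p] by (simp add: map_permutation_def)
  qed
  have "?q permutes f ` W"
    using inj p by (intro map_permutation_permutes[of f W]) (auto simp: bij_betw_def)
  moreover have "?q ` f ` e = f ` p ` e" if "e \<in> E" for e
  proof -
    have "?q (f x) = f (p x)" if "x \<in> e" for x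
      using that \<open>e \<in> E\<close> assms(4) by (intro q) auto
    then show ?thesis unfolding image_image by (rule image_cong[OF refl])
  qed
  then have "?q ` f ` e \<in> insert (f ` e') ((`) f ` E)" if "e \<in> E" for e
    using that subsetD[OF e' imageI[OF that]] by auto
  then have "(`) ?q ` (`) f ` E \<subseteq> insert (f ` e') ((`) f ` E)"
    by (intro image_subsetI) (elim imageE, simp)
  ultimately show "near_automorphism (f ` W) ((`) f ` E) ?q"
    unfolding near_automorphism_def by blast
qed

lemma exchangeable_image:
  assumes "exchangeable W E x y" "inj_on f U" "W \<subseteq> U" "E \<subseteq> Pow U"
  shows "exchangeable (f ` W) ((`) f ` E) (f x) (f y)"
  using assms(1)
proof (induction rule: exchangeable.induct)
  case (base x y)
  have "inj_on f W" using assms(2,3) inj_on_subset by blast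
  from near_automorphism_image(1)[OF base(3) assms(2-4)]
  have "near_automorphism (f ` W) ((`) f ` E) (Transposition.transpose (f x) (f y))"
    unfolding map_permutation_transpose[OF \<open>inj_on f W\<close> base(1,2)] .
  with base(1,2) show ?case by (intro exchangeable.base) simp_all
next
  case (conj p x y)
  have "x \<in> U" "y \<in> U" using exchangeable_in[OF conj(2)] assms(3) by auto
  then have eq: "map_permutation W f p (f x) = f (p x)" "map_permutation W f p (f y) = f (p y)"
    using near_automorphism_image(2)[OF conj(1) assms(2-4)] by blast+
  show ?case
    by (rule exchangeable.conj[OF near_automorphism_image(1)[OF conj(1) assms(2-4)] conj.IH,
          unfolded eq])
qed (rule exchangeable.trans)

section \<open>Rooted Fibonacci trees\<close>

text \<open>
  Fibonacci-type trees together with the vertex at which the recursion attaches them. Unlike the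
  graph predicate, the rules do not mention degrees; \<open>fibonacci_tree_rooted\<close> identifies the roots with
  the vertices of maximum degree. The indices are in successor form so that inversion rules
  determine the shape of a tree from its index.
\<close>

inductive rooted_fib :: "nat \<Rightarrow> 'a set \<Rightarrow> 'a set set \<Rightarrow> 'a \<Rightarrow> bool" where
  one: "a \<noteq> b \<Longrightarrow> rooted_fib (Suc 0) {a, b} {{a, b}} a"
| two: "a \<noteq> b \<Longrightarrow> rooted_fib (Suc (Suc 0)) {a, b} {{a, b}} a"
| join: "\<lbrakk>rooted_fib (Suc (Suc k)) V E u; rooted_fib (Suc k) W F v; V \<inter> W = {}\<rbrakk>
         \<Longrightarrow> rooted_fib (Suc (Suc (Suc k))) (V \<union> W) (insert {u, v} (E \<union> F)) u"

inductive_cases rooted_fib_oneE: "rooted_fib (Suc 0) V E r"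
inductive_cases rooted_fib_twoE: "rooted_fib (Suc (Suc 0)) V E r"
inductive_cases rooted_fib_joinE: "rooted_fib (Suc (Suc (Suc k))) V E r"

lemma rooted_fib_wf:
  "rooted_fib k V E r \<Longrightarrow> r \<in> V \<and> E \<subseteq> Pow V"
  by (induction rule: rooted_fib.induct) auto

text \<open>
  A leaf of the left part survives a join, as long as it is not the vertex that receives the new
  edge; so the leaf is chosen different from the root.
\<close>

lemma rooted_fib_leaf:
  "rooted_fib k V E r \<Longrightarrow> \<exists>l e0. l \<in> V \<and> l \<noteq> r \<and> (\<forall>e\<in>E. l \<in> e \<longrightarrow> e = e0)"
proof (induction rule: rooted_fib.induct)
  case (one a b)
  then show ?case by (intro exI[of _ b] exI[of _ "{a, b}"]) auto
next
  case (two a b)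
  then show ?case by (intro exI[of _ b] exI[of _ "{a, b}"]) auto
next
  case (join k V E u W F v)
  from join.IH(1) obtain l e0 where "l \<in> V" "l \<noteq> u" "\<forall>e\<in>E. l \<in> e \<longrightarrow> e = e0" by auto
  moreover from this(1) have "l \<notin> {u, v} \<union> W"
    using join.hyps(3) rooted_fib_wf[OF join.hyps(2)] \<open>l \<noteq> u\<close> by auto
  ultimately show ?case
    using rooted_fib_wf[OF join.hyps(2)] by (intro exI[of _ l] exI[of _ e0]) auto
qed

lemma image_image_cong:
  assumes "E \<subseteq> Pow V" "\<And>x. x \<in> V \<Longrightarrow> f x = g x"
  shows "(`) f ` E = (`) g ` E"
proof (rule image_cong[OF refl])
  fix e assume "e \<in> E"
  then have "x \<in> V" if "x \<in> e" for x using that assms(1) by auto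
  then show "f ` e = g ` e" by (intro image_cong refl assms(2))
qed

lemma rooted_fib_iso:
  assumes "rooted_fib k A EA a" "rooted_fib k B EB b"
  shows "\<exists>f. bij_betw f A B \<and> f a = b \<and> (`) f ` EA = EB"
  using assms
proof (induction arbitrary: B EB b rule: rooted_fib.induct)
  case (one a c)
  from one(2) obtain d where "b \<noteq> d" "B = {b, d}" "EB = {{b, d}}"
    by (auto elim: rooted_fib_oneE)
  with one(1) show ?case
    by (intro exI[of _ "\<lambda>x. if x = a then b else d"]) (auto simp: bij_betw_def inj_on_def)
next
  case (two a c)
  from two(2) obtain d where "b \<noteq> d" "B = {b, d}" "EB = {{b, d}}"
    by (auto elim: rooted_fib_twoE)
  with two(1) show ?case
    by (intro exI[of _ "\<lambda>x. if x = a then b else d"]) (auto simp: bij_betw_def inj_on_def)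
next
  case (join k V E u W F v)
  from join.prems obtain V' E' W' F' v' where
    B: "B = V' \<union> W'" "EB = insert {b, v'} (E' \<union> F')" "V' \<inter> W' = {}"
      "rooted_fib (Suc (Suc k)) V' E' b" "rooted_fib (Suc k) W' F' v'"
    by (auto elim: rooted_fib_joinE)
  from join.IH(1)[OF B(4)] obtain f where
    f: "bij_betw f V V'" "f u = b" "(`) f ` E = E'" by auto
  from join.IH(2)[OF B(5)] obtain g where
    g: "bij_betw g W W'" "g v = v'" "(`) g ` F = F'" by auto
  define h where "h = (\<lambda>x. if x \<in> V then f x else g x)"
  have h: "\<And>x. x \<in> V \<Longrightarrow> h x = f x" "\<And>x. x \<in> W \<Longrightarrow> h x = g x"
    using join.hyps(3) by (auto simp: h_def)
  note wf = rooted_fib_wf[OF join.hyps(1)] rooted_fib_wf[OF join.hyps(2)]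
  have "bij_betw h V V'" "bij_betw h W W'"
    using bij_betw_cong[of V h f V', OF h(1)] bij_betw_cong[of W h g W', OF h(2)] f(1) g(1)
    by simp_all
  then have "bij_betw h (V \<union> W) (V' \<union> W')"
    using B(3) by (rule bij_betw_combine)
  moreover have "(`) h ` E = (`) f ` E" "(`) h ` F = (`) g ` F"
    using wf image_image_cong[of E V h f, OF _ h(1)] image_image_cong[of F W h g, OF _ h(2)]
    by simp_all
  moreover have "h u = b" "h v = v'" using wf h f g by auto
  ultimately show ?case
    using B(1,2) f(3) g(3) by (intro exI[of _ h]) (simp add: image_Un)
qed

section \<open>Swapping two copies of a rooted tree\<close>

lemma bij_betw_swap_permutes:
  assumes "bij_betw f A B" "A \<inter> B = {}"
  obtains p where "p permutes A \<union> B" "\<And>x. x \<in> A \<Longrightarrow> p x = f x" "\<And>x. x \<in> A \<Longrightarrow> p (f x) = x"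
proof
  define p where "p = (\<lambda>x. if x \<in> A then f x else if x \<in> B then inv_into A f x else x)"
  have fA: "f x \<in> B" "f x \<notin> A" "inv_into A f (f x) = x" if "x \<in> A" for x
    using that assms by (auto simp: bij_betw_def)
  show 1: "p x = f x" if "x \<in> A" for x using that by (simp add: p_def)
  show 2: "p (f x) = x" if "x \<in> A" for x
    using fA[OF that] by (simp add: p_def)
  have out: "p x = x" if "x \<notin> A \<union> B" for x using that by (simp add: p_def)
  have "p (p x) = x" for x
  proof -
    consider "x \<in> A" | y where "y \<in> A" "x = f y" | "x \<notin> A \<union> B"
      using assms(1) by (auto simp: bij_betw_def)
    then show ?thesis by cases (simp_all add: 1 2 out)
  qed
  moreover have "p x \<in> A \<union> B" if "x \<in> A \<union> B" for x
    using that fA 1 2 assms(1) by (auto simp: bij_betw_def)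
  ultimately have "bij_betw p (A \<union> B) (A \<union> B)" by (intro bij_betw_byWitness[of _ p]) auto
  then show "p permutes A \<union> B" using out by (rule bij_imp_permutes)
qed

text \<open>
  The swap carries \<open>EA\<close> to \<open>EB\<close> and back. On an edge that meets the two copies at most in their
  roots it agrees with the transposition of the roots, so the hypothesis makes the image an edge. The
  edge \<open>e0\<close> is unconstrained: it is the one edge that the near-automorphism may destroy.
\<close>

lemma swap_copies:
  assumes A: "rooted_fib k A EA a" and B: "rooted_fib k B EB b" and disj: "A \<inter> B = {}"
    and sub: "EA \<subseteq> E" "EB \<subseteq> E"
    and rest: "\<forall>e\<in>E - EA - EB - {e0}.
      e \<inter> (A \<union> B) \<subseteq> {a, b} \<and> Transposition.transpose a b ` e \<in> E"
  shows "\<exists>p. near_automorphism (A \<union> B) E p \<and> p ` A = B \<and> p b = a"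
proof -
  from rooted_fib_iso[OF A B] obtain f where
    f: "bij_betw f A B" "f a = b" "(`) f ` EA = EB" by auto
  from bij_betw_swap_permutes[OF f(1) disj] obtain p where
    p: "p permutes A \<union> B" "\<And>x. x \<in> A \<Longrightarrow> p x = f x" "\<And>x. x \<in> A \<Longrightarrow> p (f x) = x" by blast
  note wfA = rooted_fib_wf[OF A] and wfB = rooted_fib_wf[OF B]
  have pa: "p a = b" "p b = a" using p(2,3)[of a] f(2) wfA by auto
  have EA: "p ` e = f ` e" if "e \<in> EA" for e
    using that wfA p(2) by (auto intro!: image_cong)
  have EB: "p ` f ` e = e" if "e \<in> EA" for e
  proof -
    have "p ` f ` e = (\<lambda>x. x) ` e"
      unfolding image_image using that wfA p(3) by (intro image_cong) auto
    then show ?thesis by simp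
  qed
  have "p ` e \<in> insert (p ` e0) E" if "e \<in> E" for e
  proof -
    consider "e \<in> EA" | "e \<in> EB" | "e = e0" | "e \<notin> EA" "e \<notin> EB" "e \<noteq> e0" by blast
    then show ?thesis
    proof cases
      case 1
      then show ?thesis using EA f(3) sub by auto
    next
      case 2
      then show ?thesis using EB f(3) sub by auto
    next
      case 3
      then show ?thesis by simp
    next
      case 4
      then have r: "e \<inter> (A \<union> B) \<subseteq> {a, b}" "Transposition.transpose a b ` e \<in> E"
        using rest that by auto
      have "p x = Transposition.transpose a b x" if "x \<in> e" for x
      proof (cases "x \<in> {a, b}")
        case True
        then show ?thesis using pa by auto
      next
        case False
        then have "x \<notin> A \<union> B" using r(1) that by auto
        then show ?thesis using False permutes_not_in[OF p(1)] by auto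
      qed
      then have "p ` e = Transposition.transpose a b ` e" by (rule image_cong[OF refl])
      then show ?thesis using r(2) by simp
    qed
  qed
  then have "(`) p ` E \<subseteq> insert (p ` e0) E" by (rule image_subsetI)
  with p(1) have "near_automorphism (A \<union> B) E p" unfolding near_automorphism_def by blast
  moreover have "p ` A = f ` A" by (intro image_cong refl p(2))
  then have "p ` A = B" using bij_betw_imp_surj_on[OF f(1)] by simp
  ultimately show ?thesis using pa(2) by blast
qed

text \<open>
  \<open>T_{k+1}\<close> is a copy of \<open>T_k\<close> with the same root, one edge \<open>e0\<close> leading out of it, and a part
  that does not touch the copy. For \<open>k = 1\<close> the copy is the whole tree and \<open>e0\<close> is arbitrary,
  which lets later arguments treat all indices alike.
\<close>

lemma rooted_fib_prune:
  assumes "rooted_fib (Suc (Suc k)) V E r"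
  obtains A EA e0 where "rooted_fib (Suc k) A EA r" "A \<subseteq> V" "EA \<subseteq> E"
    "\<And>e. \<lbrakk>e \<in> E; e \<notin> EA; e \<noteq> e0\<rbrakk> \<Longrightarrow> e \<inter> A = {}"
proof (cases k)
  case 0
  with assms obtain b where "r \<noteq> b" "V = {r, b}" "E = {{r, b}}"
    by (auto elim: rooted_fib_twoE)
  then show ?thesis using that[of V E] rooted_fib.one[of r b] 0 by auto
next
  case (Suc j)
  with assms obtain A EA W F v where
    V: "V = A \<union> W" "E = insert {r, v} (EA \<union> F)" "A \<inter> W = {}" and
    A: "rooted_fib (Suc (Suc j)) A EA r" and W: "rooted_fib (Suc j) W F v"
    by (auto elim: rooted_fib_joinE)
  show ?thesis
  proof (rule that)
    show "rooted_fib (Suc k) A EA r" using A Suc by simp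
    show "e \<inter> A = {}" if "e \<in> E" "e \<notin> EA" "e \<noteq> {r, v}" for e
      using that V rooted_fib_wf[OF W] by auto
  qed (use V in auto)
qed

section \<open>Exchangeable vertices of a Fibonacci tree\<close>

text \<open>
  In the induction step each of the sets \<open>V - {u}\<close> and \<open>W - {v}\<close> is a single class. It remains to link
  a vertex \<open>l\<close> of the first to \<open>v\<close> and to a vertex \<open>c\<close> of the second. On the path \<open>T_3\<close> two explicit
  transpositions do this. For larger trees \<open>l\<close> is taken in \<open>V\<close> outside the copy \<open>A\<close> that hangs below \<open>u\<close>, so
  that swapping \<open>A\<close> with the copy \<open>B\<close> around \<open>v\<close> fixes \<open>l\<close>: being exchangeable with all of \<open>A\<close>, it is then
  exchangeable with all of \<open>B\<close>.
\<close>

lemma exchangeable_nonroot: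
  assumes "rooted_fib k V E r" "x \<in> V - {r}" "y \<in> V - {r}"
  shows "exchangeable (V - {r}) E x y"
  using assms
proof (induction arbitrary: x y rule: rooted_fib.induct)
  case (one a b)
  then have "x = y" "x \<in> {a, b} - {a}" by auto
  then show ?case using exchangeable_refl by metis
next
  case (two a b)
  then have "x = y" "x \<in> {a, b} - {a}" by auto
  then show ?case using exchangeable_refl by metis
next
  case (join k V E u W F v)
  note wfV = rooted_fib_wf[OF join.hyps(1)] and wfW = rooted_fib_wf[OF join.hyps(2)]
  let ?S = "V \<union> W - {u}" and ?E = "insert {u, v} (E \<union> F)"
  have uW: "u \<notin> W" "v \<notin> V" "u \<in> V" "v \<in> W" using wfV wfW join.hyps(3) by auto
  have inV: "exchangeable ?S ?E x y" if "x \<in> V - {u}" "y \<in> V - {u}" for x y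
  proof (rule exchangeable_mono[OF join.IH(1)[OF that]])
    show "\<forall>e\<in>?E - E. e \<inter> (V - {u}) = {}"
      using uW wfW join.hyps(3) by auto
  qed auto
  have inW: "exchangeable ?S ?E x y" if "x \<in> W - {v}" "y \<in> W - {v}" for x y
  proof (rule exchangeable_mono[OF join.IH(2)[OF that]])
    show "\<forall>e\<in>?E - F. e \<inter> (W - {v}) = {}"
      using uW wfV join.hyps(3) by auto
  qed (use uW in auto)
  have "\<exists>l\<in>V - {u}. exchangeable ?S ?E l v \<and> (\<exists>c\<in>W - {v}. exchangeable ?S ?E l c)"
  proof (cases k)
    case 0
    obtain l where l: "u \<noteq> l" "V = {u, l}" "E = {{u, l}}"
      using join.hyps(1) 0 by (auto elim: rooted_fib_twoE)
    obtain c where c: "v \<noteq> c" "W = {v, c}" "F = {{v, c}}"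
      using join.hyps(2) 0 by (auto elim: rooted_fib_oneE)
    have ne: "u \<noteq> v" "u \<noteq> c" "l \<noteq> v" "l \<noteq> c" using join.hyps(3) l c by auto
    \<comment> \<open>The tree is the path \<open>l - u - v - c\<close>.\<close>
    have "(`) (Transposition.transpose l v) ` ?E \<subseteq> insert {l, c} ?E"
      using l c ne by (auto simp: insert_commute)
    then have lv: "exchangeable ?S ?E l v"
      using l c ne
      by (intro exchangeable.base) (auto simp: near_automorphism_def intro!: permutes_swap_id)
    have "(`) (Transposition.transpose v c) ` ?E \<subseteq> insert {u, c} ?E"
      using l c ne by (auto simp: insert_commute)
    then have "exchangeable ?S ?E v c"
      using l c ne
      by (intro exchangeable.base) (auto simp: near_automorphism_def intro!: permutes_swap_id)
    with lv have "exchangeable ?S ?E l c" by (rule exchangeable.trans)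
    with lv show ?thesis using l c by auto
  next
    case (Suc j)
    obtain H EH A EA a where
      V: "V = H \<union> A" "E = insert {u, a} (EH \<union> EA)" "H \<inter> A = {}" and
      H: "rooted_fib (Suc (Suc j)) H EH u" and A: "rooted_fib (Suc j) A EA a"
      using join.hyps(1) Suc by (auto elim: rooted_fib_joinE)
    obtain B EB e0 where
      B: "rooted_fib (Suc j) B EB v" and BW: "B \<subseteq> W" "EB \<subseteq> F"
        "\<And>e. \<lbrakk>e \<in> F; e \<notin> EB; e \<noteq> e0\<rbrakk> \<Longrightarrow> e \<inter> B = {}"
      using rooted_fib_prune[of j W F v] join.hyps(2) Suc by blast
    note wfs = rooted_fib_wf[OF H] rooted_fib_wf[OF A] rooted_fib_wf[OF B]
    have AB: "A \<inter> B = {}" "u \<notin> A" "u \<notin> B" using V BW join.hyps(3) wfs uW by auto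
    have roots: "a \<in> A" "v \<in> B" "u \<noteq> a" "u \<noteq> v" using wfs AB by auto
    \<comment> \<open>Both roots \<open>a\<close> and \<open>v\<close> are children of \<open>u\<close>, so transposing them permutes the two edges to \<open>u\<close>.\<close>
    have rest: "\<forall>e\<in>?E - EA - EB - {e0}.
      e \<inter> (A \<union> B) \<subseteq> {a, v} \<and> Transposition.transpose a v ` e \<in> ?E"
    proof
      fix e assume "e \<in> ?E - EA - EB - {e0}"
      then have e: "e \<in> ?E" "e \<notin> EA" "e \<notin> EB" "e \<noteq> e0" by auto
      consider "e = {u, v}" | "e = {u, a}" | "e \<in> EH" | "e \<in> F" using e(1,2) V(2) by auto
      then show "e \<inter> (A \<union> B) \<subseteq> {a, v} \<and> Transposition.transpose a v ` e \<in> ?E"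
      proof cases
        case 1
        have "Transposition.transpose a v ` e = {u, a}" using 1 roots by simp
        moreover have "e \<inter> (A \<union> B) \<subseteq> {a, v}" using 1 AB(2,3) by auto
        ultimately show ?thesis using V(2) by simp
      next
        case 2
        have "Transposition.transpose a v ` e = {u, v}" using 2 roots by simp
        moreover have "e \<inter> (A \<union> B) \<subseteq> {a, v}" using 2 AB(2,3) by auto
        ultimately show ?thesis by simp
      next
        case 3
        then have "e \<subseteq> H" using wfs(1) by auto
        then have d: "e \<inter> (A \<union> B) = {}" using V(1,3) BW(1) join.hyps(3) by auto
        then have "a \<notin> e" "v \<notin> e" using roots by auto
        with d e(1) show ?thesis by simp
      next
        case 4
        then have "e \<subseteq> W" using wfW by auto
        then have d: "e \<inter> (A \<union> B) = {}" using BW(3)[OF 4 e(3,4)] V(1) join.hyps(3) by auto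
        then have "a \<notin> e" "v \<notin> e" using roots by auto
        with d e(1) show ?thesis by simp
      qed
    qed
    have sub: "EA \<subseteq> ?E" "EB \<subseteq> ?E" using V(2) BW(2) by auto
    obtain p where p: "near_automorphism (A \<union> B) ?E p" "p ` A = B"
      using swap_copies[OF A B AB(1) sub rest] by blast
    have "A \<union> B \<subseteq> ?S" using V(1) BW(1) AB(2,3) by auto
    then have pS: "near_automorphism ?S ?E p"
      by (intro near_automorphism_mono[OF p(1)]) simp_all
    obtain l where l: "l \<in> H" "l \<noteq> u" using rooted_fib_leaf[OF H] by blast
    then have "l \<notin> A \<union> B" using V(1,3) BW(1) join.hyps(3) by auto
    moreover have "p permutes A \<union> B" using p(1) by (simp add: near_automorphism_def)
    ultimately have pl: "p l = l" using permutes_not_in by metis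
    have lB: "exchangeable ?S ?E l x" if "x \<in> B" for x
    proof -
      from that p(2) obtain y where y: "y \<in> A" "x = p y" by blast
      then have "exchangeable ?S ?E l y" using l V(1) AB(2) by (intro inV) auto
      from exchangeable.conj[OF pS this] show ?thesis using pl y(2) by simp
    qed
    obtain c where c: "c \<in> B" "c \<noteq> v" using rooted_fib_leaf[OF B] by blast
    have "l \<in> V - {u}" "c \<in> W - {v}" using l c V(1) BW(1) by auto
    with lB[OF roots(2)] lB[OF c(1)] show ?thesis by (intro bexI[of _ l] conjI bexI[of _ c])
  qed
  then obtain l c where l: "l \<in> V - {u}" "exchangeable ?S ?E l v"
    and c: "c \<in> W - {v}" "exchangeable ?S ?E l c" by blast
  have all: "exchangeable ?S ?E l x" if "x \<in> ?S" for x
  proof -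
    consider "x \<in> V - {u}" | "x = v" | "x \<in> W - {v}" using \<open>x \<in> ?S\<close> by auto
    then show ?thesis
    proof cases
      case 1
      show ?thesis using inV[OF l(1) 1] .
    next
      case 2
      then show ?thesis using l(2) by simp
    next
      case 3
      show ?thesis using exchangeable.trans[OF c(2) inW[OF c(1) 3]] .
    qed
  qed
  show ?case
    by (rule exchangeable.trans[OF exchangeable_sym[OF all] all]) fact+
qed

text \<open>
  All vertices but the root form one class. A near-automorphism \<open>p\<close> with \<open>p v = r\<close> for some \<open>v \<noteq> r\<close>, applied
  to a pair of exchangeable non-root vertices \<open>v\<close> and \<open>l\<close>, adds the root to that class. It is the swap of
  the second part with the copy around the root of the first.
\<close>

lemma exchangeable_vertices:
  assumes fib: "rooted_fib k V E r" and "x \<in> V" "y \<in> V"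
  shows "exchangeable V E x y"
proof -
  have K2: "exchangeable {a, b} {{a, b}} a b" for a b :: 'a
    by (intro exchangeable.base)
      (auto simp: near_automorphism_def insert_commute intro!: permutes_swap_id)
  have nonroot: "exchangeable V E x y" if "x \<in> V - {r}" "y \<in> V - {r}" for x y
    by (rule exchangeable_mono[OF exchangeable_nonroot[OF fib that]]) auto
  have "\<exists>z\<in>V - {r}. exchangeable V E r z"
    using fib
  proof cases
    case (one b)
    then show ?thesis using K2[of r b] by auto
  next
    case (two b)
    then show ?thesis using K2[of r b] by auto
  next
    case (join k H EH W F v)
    note wfs = rooted_fib_wf[OF join(4)] rooted_fib_wf[OF join(5)]
    obtain A EA e0 where
      A: "rooted_fib (Suc k) A EA r" and AH: "A \<subseteq> H" "EA \<subseteq> EH"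
        "\<And>e. \<lbrakk>e \<in> EH; e \<notin> EA; e \<noteq> e0\<rbrakk> \<Longrightarrow> e \<inter> A = {}"
      using rooted_fib_prune[OF join(4)] by blast
    have AW: "A \<inter> W = {}" using AH(1) join(6) by auto
    have roots: "r \<in> A" "v \<in> W" using rooted_fib_wf[OF A] wfs by auto
    \<comment> \<open>The edge \<open>{r, v}\<close> joins the roots of the two copies and is therefore preserved by the swap.\<close>
    have rest: "\<forall>e\<in>E - EA - F - {e0}.
      e \<inter> (A \<union> W) \<subseteq> {r, v} \<and> Transposition.transpose r v ` e \<in> E"
    proof
      fix e assume "e \<in> E - EA - F - {e0}"
      then have e: "e \<in> E" "e \<notin> EA" "e \<notin> F" "e \<noteq> e0" by auto
      show "e \<inter> (A \<union> W) \<subseteq> {r, v} \<and> Transposition.transpose r v ` e \<in> E"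
      proof (cases "e = {r, v}")
        case True
        then show ?thesis using e(1) by (simp add: insert_commute)
      next
        case False
        then have "e \<in> EH" using e(1,3) join(3) by auto
        then have "e \<subseteq> H" "e \<inter> A = {}" using AH(3) e(2,4) wfs(1) by auto
        then have d: "e \<inter> (A \<union> W) = {}" using join(6) by auto
        then have "r \<notin> e" "v \<notin> e" using roots by auto
        with d e(1) show ?thesis by simp
      qed
    qed
    have sub: "EA \<subseteq> E" "F \<subseteq> E" using AH(2) join(3) by auto
    obtain p where p: "near_automorphism (A \<union> W) E p" "p v = r"
      using swap_copies[OF A join(5) AW sub rest] by blast
    have "A \<union> W \<subseteq> V" using AH(1) join(2) by auto
    then have pV: "near_automorphism V E p"
      by (intro near_automorphism_mono[OF p(1)]) simp_all
    obtain l where l: "l \<in> H" "l \<noteq> r" using rooted_fib_leaf[OF join(4)] by blast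
    have "v \<in> V - {r}" "l \<in> V - {r}" "l \<noteq> v" using l wfs join(2,6) by auto
    then have "exchangeable V E v l" by (intro nonroot)
    from exchangeable.conj[OF pV this] have r: "exchangeable V E r (p l)" using p(2) by simp
    have "inj p" using p(1) permutes_inj by (auto simp: near_automorphism_def)
    then have "p l \<noteq> r" using \<open>l \<noteq> v\<close> p(2) by (metis injD)
    with r exchangeable_in[OF r] show ?thesis by auto
  qed
  then obtain z where z: "z \<in> V - {r}" "exchangeable V E r z" by blast
  have all: "exchangeable V E r x" if "x \<in> V" for x
  proof (cases "x = r")
    case True
    then show ?thesis using exchangeable_refl that by metis
  next
    case False
    then have "x \<in> V - {r}" using that by simp
    from exchangeable.trans[OF z(2) nonroot[OF z(1) this]] show ?thesis .
  qed
  show ?thesis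
    by (rule exchangeable.trans[OF exchangeable_sym[OF all[OF assms(2)]] all[OF assms(3)]])
qed

text \<open>
  The transposition of a leaf and the isolated vertex affects only the edge at the leaf, and the
  vertices of the tree are exchangeable among themselves.
\<close>

lemma exchangeable_add_isolated:
  assumes fib: "rooted_fib k (verts G) (edges G) r"
    and "x \<in> verts (add_isolated G)" "y \<in> verts (add_isolated G)"
  shows "exchangeable (verts (add_isolated G)) (edges (add_isolated G)) x y"
proof -
  let ?V = "verts (add_isolated G)" and ?E = "edges (add_isolated G)"
  have V: "?V = insert None (Some ` verts G)" and E: "?E = (`) Some ` edges G"
    by (simp_all add: add_isolated_def)
  note wf = rooted_fib_wf[OF fib]
  have old: "exchangeable ?V ?E (Some x) (Some y)" if "x \<in> verts G" "y \<in> verts G" for x y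
  proof -
    have "exchangeable (Some ` verts G) ((`) Some ` edges G) (Some x) (Some y)"
      using wf by (intro exchangeable_image[OF exchangeable_vertices[OF fib that], of _ "verts G"]) auto
    then show ?thesis unfolding V E by (rule exchangeable_mono) auto
  qed
  obtain l e0 where l: "l \<in> verts G" "\<forall>e\<in>edges G. l \<in> e \<longrightarrow> e = e0"
    using rooted_fib_leaf[OF fib] by blast
  let ?t = "Transposition.transpose None (Some l)"
  have "?t ` e \<in> insert (?t ` Some ` e0) ?E" if "e \<in> ?E" for e
  proof -
    from that E obtain d where d: "d \<in> edges G" "e = Some ` d" by auto
    show ?thesis
    proof (cases "l \<in> d")
      case True
      then have "d = e0" using l(2) d(1) by blast
      then show ?thesis using d(2) by simp
    next
      case False
      then have "None \<notin> e" "Some l \<notin> e" using d(2) by auto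
      then show ?thesis using that by simp
    qed
  qed
  then have "(`) ?t ` ?E \<subseteq> insert (?t ` Some ` e0) ?E" by (rule image_subsetI)
  moreover have "?t permutes ?V" using l(1) V by (intro permutes_swap_id) auto
  ultimately have "near_automorphism ?V ?E ?t" unfolding near_automorphism_def by blast
  then have new: "exchangeable ?V ?E None (Some l)"
    using l(1) V by (intro exchangeable.base) auto
  have all: "exchangeable ?V ?E (Some l) x" if "x \<in> ?V" for x
  proof (cases x)
    case None
    then show ?thesis using exchangeable_sym[OF new] by simp
  next
    case (Some v)
    then show ?thesis using old[OF l(1), of v] that V by auto
  qed
  show ?thesis
    by (rule exchangeable.trans[OF exchangeable_sym[OF all[OF assms(2)]] all[OF assms(3)]])
qed

section \<open>Roots are the vertices of maximum degree\<close>

lemma degree_join: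
  assumes "V \<inter> W = {}" "E \<subseteq> Pow V" "F \<subseteq> Pow W" "finite E" "u \<in> V" "v \<in> W" "x \<in> V"
  shows "degree \<lparr>verts = V \<union> W, edges = insert {u, v} (E \<union> F)\<rparr> x
    = degree \<lparr>verts = V, edges = E\<rparr> x + (if x = u then 1 else 0)"
proof -
  have "x \<notin> e" if "e \<in> F" for e
  proof -
    have "e \<subseteq> W" using assms(3) that by auto
    then show ?thesis using assms(1,7) by auto
  qed
  then have "{e \<in> insert {u, v} (E \<union> F). x \<in> e}
      = (if x = u then insert {u, v} {e \<in> E. x \<in> e} else {e \<in> E. x \<in> e})"
    using assms(1,6,7) by auto
  moreover have "{u, v} \<notin> E"
  proof
    assume "{u, v} \<in> E"
    then have "{u, v} \<subseteq> V" using assms(2) by blast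
    then show False using assms(1,6) by auto
  qed
  ultimately show ?thesis using assms(4) by (simp add: degree_def)
qed

lemma degree_join':
  assumes "V \<inter> W = {}" "E \<subseteq> Pow V" "F \<subseteq> Pow W" "finite F" "u \<in> V" "v \<in> W" "x \<in> W"
  shows "degree \<lparr>verts = V \<union> W, edges = insert {u, v} (E \<union> F)\<rparr> x
    = degree \<lparr>verts = W, edges = F\<rparr> x + (if x = v then 1 else 0)"
  using degree_join[of W V F E v u x] assms
  by (simp add: Un_commute insert_commute Int_commute)

lemma rooted_fib_finite_edges: "rooted_fib k V E r \<Longrightarrow> finite E"
  by (induction rule: rooted_fib.induct) simp_all

text \<open>
  The maximum with \<open>1\<close> accounts for \<open>T_1\<close>, which is a single edge just as \<open>T_2\<close> is.
\<close>

lemma rooted_fib_degree: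
  assumes "rooted_fib k V E r"
  shows "degree \<lparr>verts = V, edges = E\<rparr> r = max 1 (k - 1) \<and>
    (\<forall>x\<in>V. degree \<lparr>verts = V, edges = E\<rparr> x \<le> max 1 (k - 1))"
  using assms
proof (induction rule: rooted_fib.induct)
  case (one a b)
  have "{e. e = {a, b} \<and> a \<in> e} = {{a, b}}" "{e. e = {a, b} \<and> b \<in> e} = {{a, b}}" by auto
  then show ?case by (simp add: degree_def)
next
  case (two a b)
  have "{e. e = {a, b} \<and> a \<in> e} = {{a, b}}" "{e. e = {a, b} \<and> b \<in> e} = {{a, b}}" by auto
  then show ?case by (simp add: degree_def)
next
  case (join k V E u W F v)
  let ?d = "degree \<lparr>verts = V \<union> W, edges = insert {u, v} (E \<union> F)\<rparr>"
  have V: "E \<subseteq> Pow V" "u \<in> V" "finite E" and W: "F \<subseteq> Pow W" "v \<in> W" "finite F"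
    using rooted_fib_wf rooted_fib_finite_edges join.hyps by metis+
  have dV: "?d x = degree \<lparr>verts = V, edges = E\<rparr> x + (if x = u then 1 else 0)" if "x \<in> V" for x
    by (rule degree_join[OF join.hyps(3) V(1) W(1) V(3,2) W(2) that])
  have dW: "?d x = degree \<lparr>verts = W, edges = F\<rparr> x + (if x = v then 1 else 0)" if "x \<in> W" for x
    by (rule degree_join'[OF join.hyps(3) V(1) W(1) W(3) V(2) W(2) that])
  have "?d u = Suc (Suc k)" using dV[OF V(2)] join.IH(1) by simp
  moreover have "?d x \<le> Suc (Suc k)" if "x \<in> V \<union> W" for x
  proof (cases "x \<in> V")
    case True
    then have "degree \<lparr>verts = V, edges = E\<rparr> x \<le> Suc k" using join.IH(1) by auto
    then show ?thesis using dV[OF True] by auto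
  next
    case False
    then have "x \<in> W" using that by simp
    then have "degree \<lparr>verts = W, edges = F\<rparr> x \<le> max 1 k" using join.IH(2) by auto
    then show ?thesis using dW[OF \<open>x \<in> W\<close>] by (simp split: if_splits)
  qed
  ultimately show ?case by simp
qed

text \<open>
  The root of the first part gets degree \<open>k - 1\<close>, and a degree count excludes every other vertex, with
  one exception: in the path \<open>T_3\<close> both inner vertices have degree \<open>2\<close>. There the two parts are single
  edges, so they may exchange their roles in the join.
\<close>

lemma fibonacci_tree_rooted:
  assumes "fibonacci_tree k G" "max_degree_vertex G r"
  shows "rooted_fib k (verts G) (edges G) r"
  using assms
proof (induction arbitrary: r rule: fibonacci_tree.induct)
  case (fib_1 a b)
  then have "r = a \<or> r = b" by (auto simp: max_degree_vertex_def)
  then show ?case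
    using rooted_fib.one[of a b] rooted_fib.one[of b a] fib_1(1) by (auto simp: insert_commute)
next
  case (fib_2 a b)
  then have "r = a \<or> r = b" by (auto simp: max_degree_vertex_def)
  then show ?case
    using rooted_fib.two[of a b] rooted_fib.two[of b a] fib_2(1)
    by (auto simp: insert_commute numeral_2_eq_2)
next
  case (fib_step k H J u v)
  define j where "j = k - 3"
  have k: "k = Suc (Suc (Suc j))" "k - 1 = Suc (Suc j)" "k - 2 = Suc j"
    using fib_step.hyps(1) by (auto simp: j_def)
  let ?V = "verts H \<union> verts J" and ?E = "insert {u, v} (edges H \<union> edges J)"
  let ?d = "degree \<lparr>verts = ?V, edges = ?E\<rparr>"
  have H: "rooted_fib (Suc (Suc j)) (verts H) (edges H) u"
    using fib_step.IH(1)[OF fib_step.hyps(5)] k by simp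
  have J: "rooted_fib (Suc j) (verts J) (edges J) v"
    using fib_step.IH(2)[OF fib_step.hyps(6)] k by simp
  have G: "rooted_fib k ?V ?E u"
    using rooted_fib.join[OF H J fib_step.hyps(4)] k by simp
  have wfH: "edges H \<subseteq> Pow (verts H)" "u \<in> verts H" and wfJ: "edges J \<subseteq> Pow (verts J)" "v \<in> verts J"
    using rooted_fib_wf[OF H] rooted_fib_wf[OF J] by blast+
  have du: "?d u = Suc (Suc j)" using rooted_fib_degree[OF G] k by simp
  have r: "r \<in> ?V" "?d u \<le> ?d r" using fib_step.prems wfH by (auto simp: max_degree_vertex_def)
  show ?case
  proof (cases "r = u")
    case True
    then show ?thesis using G by simp
  next
    case False
    have "r \<notin> verts H"
    proof
      assume "r \<in> verts H"
      then have "?d r \<le> Suc j"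
        using degree_join[OF fib_step.hyps(4) wfH(1) wfJ(1) rooted_fib_finite_edges[OF H]
            wfH(2) wfJ(2)] False rooted_fib_degree[OF H] by (simp add: degree_def)
      with r(2) du show False by simp
    qed
    with r(1) have "r \<in> verts J" by simp
    then have dr: "?d r \<le> max 1 j + (if r = v then 1 else 0)"
      using degree_join'[OF fib_step.hyps(4) wfH(1) wfJ(1) rooted_fib_finite_edges[OF J]
          wfH(2) wfJ(2)] rooted_fib_degree[OF J] by (simp add: degree_def)
    with r(2) du have "r = v" "j = 0" by (auto split: if_splits)
    obtain l where l: "u \<noteq> l" "verts H = {u, l}" "edges H = {{u, l}}"
      using H \<open>j = 0\<close> by (auto elim: rooted_fib_twoE)
    obtain c where c: "v \<noteq> c" "verts J = {v, c}" "edges J = {{v, c}}"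
      using J \<open>j = 0\<close> by (auto elim: rooted_fib_oneE)
    have "rooted_fib (Suc (Suc (Suc 0))) (verts J \<union> verts H)
        (insert {v, u} (edges J \<union> edges H)) v"
      unfolding l(2,3) c(2,3)
      by (intro rooted_fib.join rooted_fib.one rooted_fib.two l(1) c(1))
        (use fib_step.hyps(4) l(2) c(2) in auto)
    then show ?thesis
      using k(1) \<open>j = 0\<close> \<open>r = v\<close> by (simp add: Un_commute insert_commute)
  qed
qed

section \<open>Symmetric groups generated by transpositions\<close>

lemma sym_group_on_group: "group (sym_group_on X)"
proof (rule groupI)
  fix p assume "p \<in> carrier (sym_group_on X)"
  then have "p permutes X" by (simp add: sym_group_on_def)
  then have "inv' p permutes X" "inv' p \<circ> p = id" using permutes_inv permutes_inv_o(2) by blast+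
  then show "\<exists>q\<in>carrier (sym_group_on X). q \<otimes>\<^bsub>sym_group_on X\<^esub> p = \<one>\<^bsub>sym_group_on X\<^esub>"
    by (auto simp: sym_group_on_def)
qed (auto simp: sym_group_on_def permutes_id permutes_compose comp_assoc)

lemma sym_group_on_inv:
  assumes "p permutes X"
  shows "inv\<^bsub>sym_group_on X\<^esub> p = inv' p"
  using assms
  by (intro group.inv_equality[OF sym_group_on_group])
    (simp_all add: sym_group_on_def permutes_inv permutes_inv_o)

lemma sym_group_on_iso:
  assumes "finite X"
  shows "sym_group_on X \<cong> sym_group (card X)"
proof -
  obtain h where h: "bij_betw h X {1..card X}"
    using finite_same_card_bij[of X "{1..card X}"] assms by auto
  let ?m = "map_permutation X h"
  have inj: "inj_on h X" using h by (rule bij_betw_imp_inj_on)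
  have "?m = (\<lambda>p x. if x \<in> {1..card X} then h (p (inv_into X h x)) else x)"
    using bij_betw_imp_surj_on[OF h] by (auto simp: map_permutation_def restrict_id_def fun_eq_iff)
  then have "bij_betw ?m (carrier (sym_group_on X)) (carrier (sym_group (card X)))"
    using bij_betw_permutations[OF h] by (simp add: sym_group_on_def sym_group_def)
  moreover have "?m \<in> hom (sym_group_on X) (sym_group (card X))"
    using map_permutation_permutes[OF h] map_permutation_compose'[OF inj]
    by (auto simp: hom_def sym_group_on_def sym_group_def)
  ultimately show ?thesis by (intro is_isoI) (simp add: iso_def)
qed

lemma transpose_conj:
  assumes "p permutes X"
  shows "p \<circ> Transposition.transpose x y \<circ> inv' p = Transposition.transpose (p x) (p y)"
proof
  fix z
  obtain w where "z = p w" using permutes_surj[OF assms] by (metis surjD)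
  moreover have "inv' p (p w) = w" using permutes_inverses(2)[OF assms] .
  moreover have "p a = p b \<longleftrightarrow> a = b" for a b using permutes_inj[OF assms] by (simp add: inj_eq)
  ultimately show "(p \<circ> Transposition.transpose x y \<circ> inv' p) z
      = Transposition.transpose (p x) (p y) z"
    by (simp add: Transposition.transpose_def)
qed

lemma exchangeable_in_subgroup:
  assumes K: "subgroup K (sym_group_on X)"
    and near: "\<And>p. near_automorphism X E p \<Longrightarrow> p \<in> K"
    and "exchangeable X E x y"
  shows "Transposition.transpose x y \<in> K"
  using assms(3)
proof (induction rule: exchangeable.induct)
  case (base x y)
  then show ?case by (intro near)
next
  case (conj p x y)
  have p: "p permutes X" using conj(1) by (simp add: near_automorphism_def)
  have "p \<in> K" using near[OF conj(1)] .
  then have "inv' p \<in> K"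
    using subgroup.m_inv_closed[OF K] sym_group_on_inv[OF p] by metis
  with conj.IH \<open>p \<in> K\<close> have "p \<circ> Transposition.transpose x y \<circ> inv' p \<in> K"
    using subgroup.m_closed[OF K] by (simp add: sym_group_on_def)
  then show ?case unfolding transpose_conj[OF p] .
next
  case (trans x y z)
  have comp: "p \<circ> q \<in> K" if "p \<in> K" "q \<in> K" for p q
    using subgroup.m_closed[OF K that] by (simp add: sym_group_on_def)
  consider "x = z" | "y = z" | "x \<noteq> z" "y \<noteq> z" by blast
  then show ?case
  proof cases
    case 1
    then show ?thesis using subgroup.one_closed[OF K] by (simp add: sym_group_on_def id_def)
  next
    case 2
    then show ?thesis using trans.IH(1) by simp
  next
    case 3
    show ?thesis
      using comp[OF comp[OF trans.IH] trans.IH(1)] unfolding transpose_comp_triple[OF 3] .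
  qed
qed

lemma subgroup_eq_sym_group_on:
  assumes K: "subgroup K (sym_group_on X)" and "finite X"
    and transp: "\<And>x y. x \<in> X \<Longrightarrow> y \<in> X \<Longrightarrow> Transposition.transpose x y \<in> K"
  shows "K = carrier (sym_group_on X)"
proof
  show "K \<subseteq> carrier (sym_group_on X)" using subgroup.subset[OF K] .
  show "carrier (sym_group_on X) \<subseteq> K"
  proof
    fix p assume "p \<in> carrier (sym_group_on X)"
    then have "p permutes X" by (simp add: sym_group_on_def)
    then show "p \<in> K" using \<open>finite X\<close>
    proof (induction rule: permutes_induct)
      case id
      show ?case using subgroup.one_closed[OF K] by (simp add: sym_group_on_def id_def)
    next
      case (swap a b p)
      show ?case
        using subgroup.m_closed[OF K transp[OF swap(1,2)] swap.IH]
        by (simp add: sym_group_on_def o_def)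
    qed
  qed
qed

section \<open>From exchangeable vertices to the group of feasible replacements\<close>

text \<open>
  Since a permutation preserves the number of edges, gaining the edge \<open>e'\<close> means losing exactly one
  edge \<open>e\<close>. The two cases are the neutral replacement and the replacement of \<open>e\<close> by \<open>e'\<close>.
\<close>

lemma near_automorphism_cases:
  assumes "near_automorphism X E p" "finite E"
  obtains "(`) p ` E = E"
  | e e' where "e \<in> E" "e' \<notin> E" "e' \<in> (`) p ` E" "(`) p ` E = insert e' (E - {e})"
proof -
  obtain e' where p: "p permutes X" and e': "(`) p ` E \<subseteq> insert e' E"
    using assms(1) by (auto simp: near_automorphism_def)
  define I where "I = (`) p ` E"
  have card: "card I = card E"
    unfolding I_def using permutes_inj[OF p] by (intro card_image) (auto simp: inj_on_def inj_image_eq_iff)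
  show thesis
  proof (cases "I \<subseteq> E")
    case True
    then show thesis using that(1) I_def card card_subset_eq[OF assms(2)] by blast
  next
    case False
    then have "e' \<in> I" "e' \<notin> E" using e' unfolding I_def[symmetric] by auto
    have sub: "I - {e'} \<subseteq> E" using e' unfolding I_def[symmetric] by auto
    have "finite I" using assms(2) by (simp add: I_def)
    then have "card (I - {e'}) = card E - 1" "card E > 0"
      using \<open>e' \<in> I\<close> card card_gt_0_iff[of I] by auto
    then have "card (E - (I - {e'})) = 1"
      using sub \<open>finite I\<close> by (simp add: card_Diff_subset)
    then obtain e where e: "E - (I - {e'}) = {e}" by (auto simp: card_1_singleton_iff)
    then have "e \<in> E" by auto
    moreover have "I = insert e' (E - {e})"
      using e \<open>e' \<in> I\<close> \<open>e' \<notin> E\<close> sub by blast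
    ultimately show thesis using that(2) \<open>e' \<in> I\<close> \<open>e' \<notin> E\<close> I_def by metis
  qed
qed

text \<open>
  Transporting the edges along the labelling gives an edge set \<open>L\<close> on the labels, where every pair
  is still exchangeable. The graph \<open>G\<^sub>\<sigma>\<close> is the preimage of the edges under \<open>\<sigma>\<close>, while
  near-automorphisms speak of images; so a near-automorphism \<open>p\<close> of \<open>L\<close> yields the generator \<open>\<sigma> = p\<inverse>\<close>.
  The replacement so obtained is feasible because \<open>p\<inverse>\<close> itself is an isomorphism back to \<open>G\<close>.
\<close>

lemma Fer_iso_sym_group:
  fixes G :: "'a graph"
  assumes G: "simple_graph G" and lab: "labeling G X lab"
    and exch: "\<And>x y. x \<in> verts G \<Longrightarrow> y \<in> verts G \<Longrightarrow> exchangeable (verts G) (edges G) x y"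
  shows "Fer G X lab \<cong> sym_group (card (verts G))"
proof -
  let ?V = "verts G" and ?g = "vertex_of G lab"
  define L where "L = (`) lab ` edges G"
  have bij: "bij_betw lab ?V X" using lab by (simp add: labeling_def)
  have inj: "inj_on lab ?V" and X: "X = lab ` ?V" using bij by (auto simp: bij_betw_def)
  have g_lab: "?g (lab v) = v" if "v \<in> ?V" for v
    using inv_into_f_f[OF inj that] by (simp add: vertex_of_def)
  have lab_g: "lab (?g i) = i" "?g i \<in> ?V" if "i \<in> X" for i
    using that X g_lab by auto
  have bij_g: "bij_betw ?g X ?V" unfolding vertex_of_def by (rule bij_betw_inv_into[OF bij])
  have edge: "e \<subseteq> ?V" "card e = 2" if "e \<in> edges G" for e
    using G that by (auto simp: simple_graph_def)
  have finV: "finite ?V" and sub: "edges G \<subseteq> Pow ?V" using G by (auto simp: simple_graph_def)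
  then have finX: "finite X" and finL: "finite L"
    using X finite_subset[OF sub] by (auto simp: L_def)
  have L_edge: "\<exists>i j. i \<in> X \<and> j \<in> X \<and> i \<noteq> j \<and> l = {i, j}" if "l \<in> L" for l
  proof -
    from that obtain e where e: "e \<in> edges G" "l = lab ` e" by (auto simp: L_def)
    from edge(2)[OF e(1)] obtain a b where ab: "e = {a, b}" "a \<noteq> b" by (auto simp: card_2_iff)
    then have "a \<in> ?V" "b \<in> ?V" using edge(1)[OF e(1)] by auto
    then show ?thesis
      using ab e(2) X inj_onD[OF inj, of a b] by (intro exI[of _ "lab a"] exI[of _ "lab b"]) auto
  qed
  have gL: "(`) ?g ` L = edges G"
  proof -
    have "?g ` lab ` e = e" if "e \<in> edges G" for e
    proof -
      have "(\<lambda>x. ?g (lab x)) ` e = (\<lambda>x. x) ` e"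
        using edge(1)[OF that] g_lab by (intro image_cong refl) auto
      then show ?thesis by (simp add: image_image)
    qed
    then have "(\<lambda>e. ?g ` lab ` e) ` edges G = (\<lambda>e. e) ` edges G" by (intro image_cong refl)
    then show ?thesis by (simp add: L_def image_image)
  qed
  have mem_edges: "{?g i, ?g j} \<in> edges G \<longleftrightarrow> {i, j} \<in> L" if "i \<in> X" "j \<in> X" for i j
  proof
    assume "{?g i, ?g j} \<in> edges G"
    then have "lab ` {?g i, ?g j} \<in> L" unfolding L_def by (rule imageI)
    then show "{i, j} \<in> L" using lab_g that by simp
  next
    assume "{i, j} \<in> L"
    then have "?g ` {i, j} \<in> edges G" unfolding gL[symmetric] by (rule imageI)
    then show "{?g i, ?g j} \<in> edges G" by simp
  qed
  have label_edges: "label_edges G X lab = L"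
  proof
    show "label_edges G X lab \<subseteq> L" using mem_edges by (auto simp: label_edges_def)
    show "L \<subseteq> label_edges G X lab"
    proof
      fix l assume "l \<in> L"
      with L_edge obtain i j where "i \<in> X" "j \<in> X" "l = {i, j}" by blast
      with mem_edges \<open>l \<in> L\<close> show "l \<in> label_edges G X lab" unfolding label_edges_def by blast
    qed
  qed
  have permuted: "permuted_graph G X lab (inv' p) = \<lparr>verts = ?V, edges = (`) ?g ` (`) p ` L\<rparr>"
    if p: "p permutes X" for p
  proof -
    have "{{?g i, ?g j} | i j. i \<in> X \<and> j \<in> X \<and> {inv' p i, inv' p j} \<in> L} = (`) ?g ` (`) p ` L"
      (is "?A = ?B")
    proof
      show "?A \<subseteq> ?B"
      proof
        fix e assume "e \<in> ?A"
        then obtain i j where ij: "e = {?g i, ?g j}" "{inv' p i, inv' p j} \<in> L" by blast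
        have "e = ?g ` p ` {inv' p i, inv' p j}" using ij(1) permutes_inverses(1)[OF p] by simp
        with ij(2) show "e \<in> ?B" by blast
      qed
      show "?B \<subseteq> ?A"
      proof
        fix e assume "e \<in> ?B"
        then obtain l where l: "l \<in> L" "e = ?g ` p ` l" by blast
        with L_edge obtain i j where ij: "i \<in> X" "j \<in> X" "l = {i, j}" by blast
        have "e = {?g (p i), ?g (p j)}" using l(2) ij(3) by simp
        moreover have "p i \<in> X" "p j \<in> X" using ij permutes_in_image[OF p] by auto
        moreover have "{inv' p (p i), inv' p (p j)} \<in> L"
          using l(1) ij(3) permutes_inverses(2)[OF p] by simp
        ultimately show "e \<in> ?A" by blast
      qed
    qed
    then show ?thesis by (simp add: permuted_graph_def label_edges)
  qed
  let ?S = "\<Union>\<rho>\<in>feasible_replacements G X lab. Fer_perms G X lab \<rho>"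
  have gen: "inv' p \<in> ?S" if near: "near_automorphism X L p" for p
  proof -
    have p: "p permutes X" using near by (simp add: near_automorphism_def)
    have p': "inv' p permutes X" using permutes_inv[OF p] .
    show ?thesis
    proof (cases rule: near_automorphism_cases[OF near finL])
      case 1
      then have "permuted_graph G X lab (inv' p) = G" using permuted[OF p] gL by simp
      then have "inv' p \<in> Fer_perms G X lab Neutral" using p' by (simp add: Fer_perms_def)
      then show ?thesis by (auto simp: feasible_replacements_def)
    next
      case (2 e e')
      obtain r s where rs: "r \<in> X" "s \<in> X" "e = {r, s}" using L_edge[OF 2(1)] by blast
      obtain l where l: "l \<in> L" "e' = p ` l" using 2(3) by blast
      then obtain i j where ij: "i \<in> X" "j \<in> X" "i \<noteq> j" "l = {i, j}" using L_edge by blast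
      define k m where "k = p i" and "m = p j"
      have km: "k \<in> X" "m \<in> X" "k \<noteq> m" "e' = {k, m}"
        using ij l permutes_in_image[OF p] permutes_inj[OF p]
        by (auto simp: k_def m_def inj_eq)
      let ?r = "Replace {r, s} {k, m}"
      have "L \<subseteq> Pow X" using L_edge by blast
      then have "(`) ?g ` (L - {e}) = (`) ?g ` L - (`) ?g ` {e}"
        using bij_betw_imp_inj_on[OF bij_betw_Pow[OF bij_g]] 2(1)
        by (intro inj_on_image_set_diff[of _ "Pow X"]) auto
      then have app: "apply_replacement G lab ?r = \<lparr>verts = ?V, edges = (`) ?g ` (`) p ` L\<rparr>"
        unfolding 2(4) using gL rs(3) km(4) by simp
      then have perm: "inv' p \<in> Fer_perms G X lab ?r"
        using permuted[OF p] p' by (simp add: Fer_perms_def)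
      \<comment> \<open>The inverse of \<open>p\<close>, read on vertices instead of labels, undoes the replacement.\<close>
      let ?f = "?g \<circ> inv' p \<circ> lab"
      have "bij_betw ?f ?V ?V"
        using bij permutes_imp_bij[OF p'] bij_g by (auto intro: bij_betw_trans)
      moreover have "?f ` ?g ` p ` l = ?g ` l" if "l \<in> L" for l
      proof -
        have "lab (?g (p x)) = p x" if "x \<in> l" for x
          using that \<open>l \<in> L\<close> \<open>L \<subseteq> Pow X\<close> lab_g(1) permutes_in_image[OF p] by auto
        then have "(\<lambda>x. ?f (?g (p x))) ` l = ?g ` l"
          by (intro image_cong refl) (simp add: permutes_inverses(2)[OF p])
        then show ?thesis by (simp add: image_image)
      qed
      then have "(\<lambda>l. ?f ` ?g ` p ` l) ` L = (`) ?g ` L" by (intro image_cong refl)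
      then have "edges G = (\<lambda>e. ?f ` e) ` (`) ?g ` (`) p ` L"
        unfolding gL by (simp only: image_image)
      ultimately have "graph_iso (apply_replacement G lab ?r) G"
        unfolding app graph_iso_def by (intro exI[of _ ?f]) simp
      moreover have "{?g r, ?g s} \<in> edges G" "{?g k, ?g m} \<notin> edges G"
        using mem_edges rs km 2(1,2) by auto
      ultimately have "?r \<in> feasible_replacements G X lab"
        unfolding feasible_replacements_def using rs(1,2) km(1-3) by blast
      with perm show ?thesis by blast
    qed
  qed
  define K where "K = carrier (Fer G X lab)"
  have K: "subgroup K (sym_group_on X)"
    unfolding K_def Fer_def by (rule group.subgroup_subgroup_generated[OF sym_group_on_group])
  have near: "p \<in> K" if "near_automorphism X L p" for p
  proof -
    have p: "p permutes X" using that by (simp add: near_automorphism_def)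
    then have p': "inv' p permutes X" by (rule permutes_inv)
    then have "inv' p \<in> K"
      using gen[OF that] unfolding K_def Fer_def carrier_subgroup_generated
      by (intro generate.incl) (simp add: sym_group_on_def)
    from subgroup.m_inv_closed[OF K this] show ?thesis
      unfolding sym_group_on_inv[OF p'] permutes_inv_inv[OF p] .
  qed
  have "Transposition.transpose x y \<in> K" if "x \<in> X" "y \<in> X" for x y
  proof (rule exchangeable_in_subgroup[OF K near])
    have "exchangeable X L (lab (?g x)) (lab (?g y))"
      using exchangeable_image[OF exch inj order_refl sub, of "?g x" "?g y"] lab_g(2) that
      unfolding L_def X by auto
    then show "exchangeable X L x y" using lab_g(1) that by simp
  qed
  from subgroup_eq_sym_group_on[OF K finX this]
  have "Fer G X lab = sym_group_on X"
    unfolding K_def by (simp add: Fer_def subgroup_generated_def sym_group_on_def)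
  then show ?thesis
    using sym_group_on_iso[OF finX] bij_betw_same_card[OF bij] by simp
qed

lemma simple_graph_add_isolated:
  assumes "simple_graph G"
  shows "simple_graph (add_isolated G)" "card (verts (add_isolated G)) = card (verts G) + 1"
  using assms by (auto simp: simple_graph_def add_isolated_def card_image)

theorem theorem9:
  fixes k :: nat and G :: "'a graph"
  assumes "k \<ge> 1" and "fibonacci_tree k G"
  shows "local_amoeba G \<and> global_amoeba G"
proof -
  have G: "simple_graph G" "verts G \<noteq> {}" using fibonacci_tree_simple[OF assms(2)] by auto
  then obtain r where "max_degree_vertex G r" using ex_max_degree_vertex by blast
  with assms(2) have fib: "rooted_fib k (verts G) (edges G) r" by (rule fibonacci_tree_rooted)
  have "local_amoeba G"
    unfolding local_amoeba_def
    using G(1) Fer_iso_sym_group[OF G(1) _ exchangeable_vertices[OF fib]] by blast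
  moreover have "global_amoeba G"
    unfolding global_amoeba_def
  proof (intro conjI allI impI)
    fix X :: "nat set" and lab
    assume "labeling (add_isolated G) X lab"
    from Fer_iso_sym_group[OF simple_graph_add_isolated(1)[OF G(1)] this
        exchangeable_add_isolated[OF fib]]
    show "Fer (add_isolated G) X lab \<cong> sym_group (card (verts G) + 1)"
      unfolding simple_graph_add_isolated(2)[OF G(1)] .
  qed (rule G(1))
  ultimately show ?thesis by blast
qed

end
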